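(* Let $n,s\in\mathbb{N}$, $S\subset\mathbb{R}^s$, $\vec{b}\in\mathbb{R}^n$, and let $A:\mathbb{R}^s\to\mathbb{R}^{n\times n}$ be linear such that $A(\vec{\sigma})$ is symmetric positive definite for every $\vec{\sigma}\in S$. Then for every $\vec{\sigma}\in S$ and every $j\in\mathbb{N}$, $j\ge1$, $$K_j(A(\vec{\sigma}),\vec{b})\subset CK_j(A,\vec{b}),$$ and, if $\vec{x}(\vec{\sigma})$ is the solution of $A(\vec{\sigma})\vec{x}(\vec{\sigma})=\vec{b}$ and $\hat{\vec{x}}_j(\vec{\sigma})$ is its subspace solution from the compound Krylov subspace $CK_j(A,\vec{b})$, $$\|\vec{x}(\vec{\sigma})-\hat{\vec{x}}_j(\vec{\sigma})\|_{A(\vec{\sigma})}\le 2\left(\frac{\sqrt{\kappa(A(\vec{\sigma}))}-1}{\sqrt{\kappa(A(\vec{\sigma}))}+1}\right)^j\|\vec{x}(\vec{\sigma})\|_{A(\vec{\sigma})}.$$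
   Context: Notation. For a symmetric positive definite $B$, $\|\vec{z}\|_B=(\vec{z}^TB\vec{z})^{1/2}$ and $\kappa(B)=\|B\|_2\|B^{-1}\|_2$. The $j$th Krylov subspace is $K_j(B,\vec{b})=\mathrm{span}\{\vec{b},B\vec{b},\ldots,B^{j-1}\vec{b}\}$. Linearisation function: write $A(\vec{\sigma})=\sum_{i=1}^s\sigma_iA_i$ with $A_i\in\mathbb{R}^{n\times n}$ independent of $\vec{\sigma}$. For any $m$ and $C\in\mathbb{R}^{n\times m}$ set $L(C)=\begin{bmatrix}A_1C&A_2C&\cdots&A_sC\end{bmatrix}\in\mathbb{R}^{n\times sm}$; $L^1=L$ and $L^k=L\circ L^{k-1}$ for $k>1$, so $L^k(\vec{b})\in\mathbb{R}^{n\times s^k}$. Compound Krylov subspaces: $CK_1=\mathrm{span}(\vec{b})$ and $CK_{j+1}=\mathrm{range}(L^j(\vec{b}))+CK_j$ for $j\ge1$, where $CK_j=CK_j(A,\vec{b})$. Subspace solution: for a symmetric positive definite $B$, $\vec{g}\in\mathbb{R}^n$ and a subspace $V\subset\mathbb{R}^n$ with basis given by the columns of $Q$, the subspace solution from $V$ to $B\vec{y}=\vec{g}$ is $\hat{\vec{y}}=Q\vec{z}$, where $Q^TBQ\vec{z}=Q^T\vec{g}$ (and $\hat{\vec y}=0$ if $V=\{0\}$). It does not depend on the choice of basis. *)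

theory Defs
  imports "HOL-Analysis.Analysis"
begin

definition spd :: "real^'n^'n \<Rightarrow> bool" where
  "spd B \<longleftrightarrow> transpose B = B \<and> (\<forall>x. x \<noteq> 0 \<longrightarrow> x \<bullet> (B *v x) > 0)"

definition energy_norm :: "real^'n^'n \<Rightarrow> real^'n \<Rightarrow> real" where
  "energy_norm B z = sqrt (z \<bullet> (B *v z))"

definition cond2 :: "real^'n^'n \<Rightarrow> real" where
  "cond2 B = onorm ((*v) B) * onorm ((*v) (matrix_inv B))"

text \<open>Powers of a matrix are iterates of \<open>(*v)\<close>, because \<open>^\<close> on \<open>real^'n^'n\<close> is the
  componentwise power.\<close>

definition krylov :: "real^'n^'n \<Rightarrow> real^'n \<Rightarrow> nat \<Rightarrow> (real^'n) set" where
  "krylov B b j = span {((*v) B ^^ i) b | i. i < j}"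

text \<open>The number of columns of \<open>L\<^sup>k(b)\<close> depends on \<open>k\<close>. A matrix with \<open>m\<close> columns is
  therefore represented by the list, of length \<open>m\<close>, of its columns. The linear order on the index
  type \<open>'s\<close> only fixes the order \<open>A\<^sub>1, \<dots>, A\<^sub>s\<close> of the blocks.\<close>

definition mult_vec :: "(real^'n) list \<Rightarrow> (nat \<Rightarrow> real) \<Rightarrow> real^'n" where
  "mult_vec C z = (\<Sum>i<length C. z i *\<^sub>R C ! i)"

definition mat_range :: "(real^'n) list \<Rightarrow> (real^'n) set" where
  "mat_range C = range (mult_vec C)"

definition coeff_mat :: "(real^'s \<Rightarrow> real^'n^'n) \<Rightarrow> 's \<Rightarrow> real^'n^'n" where
  "coeff_mat A i = A (axis i 1)"

lemma linear_coeff_mat_expansion: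
  fixes A :: "real^'s \<Rightarrow> real^'n^'n"
  assumes "linear A"
  shows "A \<sigma> = (\<Sum>i\<in>UNIV. \<sigma> $ i *\<^sub>R coeff_mat A i)"
proof -
  have "A \<sigma> = A (\<Sum>i\<in>UNIV. \<sigma> $ i *\<^sub>R axis i 1)"
    using basis_expansion[of \<sigma>] by (simp add: scalar_mult_eq_scaleR)
  then show ?thesis
    using assms by (simp add: linear_sum linear_cmul coeff_mat_def o_def)
qed

definition linearisation ::
    "(real^('s::{finite,linorder}) \<Rightarrow> real^'n^'n) \<Rightarrow> (real^'n) list \<Rightarrow> (real^'n) list" where
  "linearisation A C =
     concat (map (\<lambda>i. map ((*v) (coeff_mat A i)) C) (sorted_list_of_set UNIV))"

text \<open>The value at \<open>0\<close> is a convention; the compound Krylov subspaces start at index \<open>1\<close>.\<close>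

fun compound_krylov ::
    "(real^('s::{finite,linorder}) \<Rightarrow> real^'n^'n) \<Rightarrow> real^'n \<Rightarrow> nat \<Rightarrow> (real^'n) set" where
  "compound_krylov A b 0 = {0}"
| "compound_krylov A b (Suc 0) = span {b}"
| "compound_krylov A b (Suc (Suc j)) =
     {u + v | u v. u \<in> mat_range ((linearisation A ^^ Suc j) [b]) \<and>
                   v \<in> compound_krylov A b (Suc j)}"

text \<open>A basis \<open>Q\<close> of \<open>V\<close> is again a list of columns, and the matrix \<open>Q\<^sup>TBQ\<close> is written out
  entrywise. The empty basis yields the solution \<open>0\<close> from \<open>V = {0}\<close>.\<close>

definition is_basis_list :: "(real^'n) list \<Rightarrow> (real^'n) set \<Rightarrow> bool" where
  "is_basis_list Q V \<longleftrightarrow> distinct Q \<and> independent (set Q) \<and> span (set Q) = V"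

definition is_subspace_solution ::
    "real^'n^'n \<Rightarrow> real^'n \<Rightarrow> (real^'n) set \<Rightarrow> real^'n \<Rightarrow> bool" where
  "is_subspace_solution B g V y \<longleftrightarrow>
     (\<exists>Q z. is_basis_list Q V \<and>
        (\<forall>i<length Q. (\<Sum>k<length Q. (Q ! i \<bullet> (B *v Q ! k)) * z k) = Q ! i \<bullet> g) \<and>
        y = mult_vec Q z)"

definition subspace_solution ::
    "real^'n^'n \<Rightarrow> real^'n \<Rightarrow> (real^'n) set \<Rightarrow> real^'n" where
  "subspace_solution B g V = (THE y. is_subspace_solution B g V y)"

lemma mult_vec_in_span: "mult_vec Q z \<in> span (set Q)"
  unfolding mult_vec_def by (intro span_sum span_scale span_base) auto

lemma mult_vec_gram:
  "(\<Sum>k<length Q. (q \<bullet> (B *v Q ! k)) * z k) = q \<bullet> (B *v mult_vec Q z)"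
  unfolding mult_vec_def
  by (simp add: linear_sum[OF matrix_vector_mul_linear] matrix_vector_mult_scaleR
      inner_sum_right mult.commute)

lemma span_imp_mult_vec:
  assumes "y \<in> span (set Q)" "distinct Q"
  shows "\<exists>z. y = mult_vec Q z"
proof -
  obtain u where u: "y = (\<Sum>v\<in>set Q. u v *\<^sub>R v)"
    using assms(1) by (auto simp: span_finite)
  have "bij_betw ((!) Q) {..<length Q} (set Q)"
    using assms(2) by (rule bij_betw_nth) auto
  then have "(\<Sum>i<length Q. u (Q ! i) *\<^sub>R Q ! i) = (\<Sum>v\<in>set Q. u v *\<^sub>R v)"
    by (rule sum.reindex_bij_betw)
  then have "y = mult_vec Q (\<lambda>i. u (Q ! i))"
    using u by (simp add: mult_vec_def)
  then show ?thesis by blast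
qed

lemma is_subspace_solution_iff:
  assumes "subspace V"
  shows "is_subspace_solution B g V y \<longleftrightarrow>
    y \<in> V \<and> (\<forall>v\<in>V. v \<bullet> (B *v y) = v \<bullet> g)"
proof
  assume "is_subspace_solution B g V y"
  then obtain Q z where Q: "is_basis_list Q V" and y: "y = mult_vec Q z"
    and eq: "\<forall>i<length Q. Q ! i \<bullet> (B *v y) = Q ! i \<bullet> g"
    unfolding is_subspace_solution_def mult_vec_gram by blast
  have "set Q \<subseteq> {v. v \<bullet> (B *v y - g) = 0}"
    using eq by (auto simp: in_set_conv_nth inner_diff_right)
  moreover have "subspace {v. v \<bullet> (B *v y - g) = 0}"
    by (auto simp: subspace_def inner_add_left)
  ultimately have "span (set Q) \<subseteq> {v. v \<bullet> (B *v y - g) = 0}"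
    by (rule span_minimal)
  then show "y \<in> V \<and> (\<forall>v\<in>V. v \<bullet> (B *v y) = v \<bullet> g)"
    using Q mult_vec_in_span[of Q z] y
    by (auto simp: is_basis_list_def inner_diff_right)
next
  assume y: "y \<in> V \<and> (\<forall>v\<in>V. v \<bullet> (B *v y) = v \<bullet> g)"
  obtain X where X: "X \<subseteq> V" "independent X" "V \<subseteq> span X"
    by (rule basis_exists[of V])
  have "finite X" using X(2) by (rule independent_imp_finite)
  then obtain Q where Q: "set Q = X" "distinct Q" using finite_distinct_list[of X] by auto
  have "span X = V" using X assms by (simp add: span_minimal subset_antisym)
  then have basis: "is_basis_list Q V" using Q X by (simp add: is_basis_list_def)
  obtain z where z: "y = mult_vec Q z"
    using span_imp_mult_vec[of y Q] Q y \<open>span X = V\<close> by auto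
  have "\<forall>i<length Q. Q ! i \<bullet> (B *v y) = Q ! i \<bullet> g"
    using y Q X(1) by (metis nth_mem subsetD)
  then show "is_subspace_solution B g V y"
    unfolding is_subspace_solution_def mult_vec_gram using basis z by blast
qed

lemma spd_mult_eq_0:
  assumes "spd B" "x \<bullet> (B *v x) = 0"
  shows "x = 0"
  using assms unfolding spd_def by (metis less_irrefl)

lemma spd_inj:
  assumes "spd B"
  shows "inj ((*v) B)"
proof (rule injI)
  fix x y assume "B *v x = B *v y"
  then have "(x - y) \<bullet> (B *v (x - y)) = 0" by (simp add: matrix_vector_mult_diff_distrib)
  then show "x = y" using spd_mult_eq_0[OF assms] by fastforce
qed

lemma spd_inner_commute:
  assumes "spd B"
  shows "x \<bullet> (B *v y) = (B *v x) \<bullet> y"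
  using assms unfolding spd_def
  by (metis dot_lmul_matrix vector_transpose_matrix)

lemma ex1_subspace_solution:
  assumes B: "spd B" and V: "subspace V"
  shows "\<exists>!y. is_subspace_solution B g V y"
proof (rule ex_ex1I)
  define W where "W = {x \<in> UNIV. \<forall>u\<in>(*v) B ` V. orthogonal u x}"
  have lin: "linear ((*v) B)" by simp
  have W: "subspace W"
    unfolding W_def by (auto simp: subspace_def orthogonal_def inner_add_right)
  have dW: "dim W + dim ((*v) B ` V) = CARD('a)"
    using dim_subspace_orthogonal_to_vectors[of "(*v) B ` V" UNIV]
      linear_subspace_image[OF lin V] by (simp add: W_def)
  have dV: "dim ((*v) B ` V) = dim V"
    using dim_image_eq[OF lin] spd_inj[OF B] inj_on_subset by blast
  have "V \<inter> W \<subseteq> {0}"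
  proof
    fix x assume "x \<in> V \<inter> W"
    then have "x \<bullet> (B *v x) = 0" by (auto simp: W_def orthogonal_def inner_commute)
    then show "x \<in> {0}" using spd_mult_eq_0[OF B] by simp
  qed
  then have "dim (V \<inter> W) = 0" by (simp add: dim_eq_0)
  then have "dim {x + y | x y. x \<in> V \<and> y \<in> W} = CARD('a)"
    using dim_sums_Int[OF V W] dW dV by linarith
  then have "{x + y | x y. x \<in> V \<and> y \<in> W} = UNIV"
    using subspace_sums[OF V W] dim_eq_full[of "{x + y | x y. x \<in> V \<and> y \<in> W}"]
    by (simp add: span_eq_iff[THEN iffD2])
  moreover obtain x where x: "B *v x = g"
    using linear_injective_imp_surjective[OF lin spd_inj[OF B]] by (metis surjD)
  ultimately have "x \<in> {x + y | x y. x \<in> V \<and> y \<in> W}" by simp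
  then obtain y w where yw: "x = y + w" "y \<in> V" "w \<in> W" by auto
  have "v \<bullet> (B *v y) = v \<bullet> g" if "v \<in> V" for v
  proof -
    have "v \<bullet> (B *v w) = 0"
      using that yw(3) spd_inner_commute[OF B, of v w] by (auto simp: W_def orthogonal_def)
    then show ?thesis
      using x yw(1) by (auto simp: matrix_vector_right_distrib inner_add_right)
  qed
  then show "\<exists>y. is_subspace_solution B g V y"
    using yw(2) is_subspace_solution_iff[OF V] by blast
next
  fix y y' assume *: "is_subspace_solution B g V y" "is_subspace_solution B g V y'"
  then have "y - y' \<in> V" using V by (simp add: is_subspace_solution_iff subspace_diff)
  then have "(y - y') \<bullet> (B *v (y - y')) = 0"
    using * V by (simp add: is_subspace_solution_iff matrix_vector_mult_diff_distrib
        inner_diff_right)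
  then show "y = y'" using spd_mult_eq_0[OF B] by fastforce
qed

end

theory Submission
  imports Defs
begin

text \<open>
  By Galerkin orthogonality the subspace solution minimises the energy error, so it suffices to
  find \<open>p\<close> of degree at most \<open>j\<close> with \<open>p(0) = 1\<close> and \<open>p(B)\<close> small in the energy norm; \<open>p\<close> is the
  scaled and shifted Chebyshev polynomial. The spectral theorem is avoided: for a self-adjoint \<open>M\<close>
  with numerical range in \<open>[-1, 1]\<close> the Pell identity \<open>T\<^sub>k\<^sup>2 + (1 - M\<^sup>2) U\<^sub>k\<^sub>-\<^sub>1\<^sup>2 = 1\<close> and
  \<open>1 - M\<^sup>2 \<ge> 0\<close> give that \<open>T\<^sub>k(M)\<close> is a contraction.
\<close>

section \<open>Chebyshev polynomials of a self-adjoint contraction\<close>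

text \<open>The pair \<open>(T\<^sub>k(M) x, U\<^sub>k\<^sub>-\<^sub>1(M) x)\<close>, with \<open>U\<^sub>-\<^sub>1 = 0\<close>.\<close>

primrec chebyshev_pair :: "('a::real_vector \<Rightarrow> 'a) \<Rightarrow> 'a \<Rightarrow> nat \<Rightarrow> 'a \<times> 'a" where
  "chebyshev_pair M x 0 = (x, 0)"
| "chebyshev_pair M x (Suc k) =
    (let (t, u) = chebyshev_pair M x k in (M t - (u - M (M u)), t + M u))"

text \<open>The form is abstract so that it can be the energy inner product of \<open>B\<close>, for
  which polynomials in \<open>B\<close> are self-adjoint. Its positive semidefiniteness is implicit
  in \<open>numerical_range\<close>.\<close>

locale selfadjoint_numerical_contraction =
  fixes ip :: "'a::real_vector \<Rightarrow> 'a \<Rightarrow> real" and M :: "'a \<Rightarrow> 'a"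
  assumes bilinear: "bilinear ip"
    and commute: "ip x y = ip y x"
    and linear: "linear M"
    and selfadjoint: "ip (M x) y = ip x (M y)"
    and numerical_range: "\<bar>ip x (M x)\<bar> \<le> ip x x"
begin

lemmas ip_simps =
  bilinear_ladd[OF bilinear] bilinear_radd[OF bilinear]
  bilinear_lsub[OF bilinear] bilinear_rsub[OF bilinear]

text \<open>\<open>2(1 - M\<^sup>2) = (1 - M)(1 + M)(1 - M) + (1 + M)(1 - M)(1 + M)\<close>, a sum of two
  positive operators.\<close>

lemma contraction: "ip (M v) (M v) \<le> ip v v"
proof -
  let ?p = "v + M v" and ?q = "v - M v"
  have "0 \<le> ip ?q ?q + ip ?q (M ?q)" "0 \<le> ip ?p ?p - ip ?p (M ?p)"
    using numerical_range[of ?p] numerical_range[of ?q] by linarith+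
  then have "0 \<le> (ip ?q ?q + ip ?q (M ?q)) + (ip ?p ?p - ip ?p (M ?p))"
    by linarith
  also have "\<dots> = 2 * (ip v v - ip (M v) (M v))"
    using selfadjoint commute
    by (simp add: ip_simps linear_add[OF linear] linear_diff[OF linear])
  finally show ?thesis by simp
qed

text \<open>This is the Pell identity paired with \<open>x\<close>. One step of the recursion
  multiplies \<open>t + u sqrt(M^2 - 1)\<close> by \<open>M + sqrt(M^2 - 1)\<close>, an element of
  norm 1, so the quadratic form is preserved.\<close>

lemma chebyshev_pair_Pell:
  assumes "chebyshev_pair M x k = (t, u)"
  shows "ip t t + (ip u u - ip (M u) (M u)) = ip x x"
  using assms
proof (induction k arbitrary: t u)
  case 0
  then show ?case
    by (simp add: linear_0[OF linear] bilinear_lzero[OF bilinear])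
next
  case (Suc k)
  obtain t' u' where tu': "chebyshev_pair M x k = (t', u')" by fastforce
  have t: "t = M t' - (u' - M (M u'))" and u: "u = t' + M u'"
    using Suc.prems tu' by auto
  \<comment> \<open>All mixed terms are brought to one orientation, after which they cancel.\<close>
  have swap: "ip u' t' = ip t' u'" "ip u' (M t') = ip t' (M u')"
      "ip u' (M (M t')) = ip t' (M (M u'))" "ip u' (M (M (M t'))) = ip t' (M (M (M u')))"
    using selfadjoint commute by metis+
  have "ip t t + (ip u u - ip (M u) (M u)) = ip t' t' + (ip u' u' - ip (M u') (M u'))"
    unfolding t u
    by (simp add: ip_simps linear_add[OF linear] linear_diff[OF linear] selfadjoint swap)
  then show ?case using Suc.IH[OF tu'] by simp
qed

lemma chebyshev_contraction:
  "ip (fst (chebyshev_pair M x k)) (fst (chebyshev_pair M x k)) \<le> ip x x"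
  using chebyshev_pair_Pell[of x k] contraction
  by (smt (verit) prod.collapse)

end

text \<open>With z = exp \<theta> the scalar is cosh \<theta>, and the pair is cosh(k \<theta>) and
  sinh(k \<theta>) / sinh \<theta>.\<close>

lemma chebyshev_pair_real:
  fixes z :: real
  assumes z: "z > 1"
  shows "chebyshev_pair ((*) ((z + 1 / z) / 2)) 1 k =
    ((z ^ k + (1 / z) ^ k) / 2, (z ^ k - (1 / z) ^ k) / (z - 1 / z))"
proof (induction k)
  case 0
  then show ?case by simp
next
  case (Suc k)
  define w where "w = 1 / z"
  have zw: "z * w = 1" and d: "z - w \<noteq> 0"
    using z by (auto simp: w_def field_simps power2_eq_square[symmetric] power2_eq_1_iff)
  define P where "P = z ^ k"
  define Q where "Q = w ^ k"
  let ?m = "(z + w) / 2" and ?t = "(P + Q) / 2" and ?u = "(P - Q) / (z - w)"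
  \<comment> \<open>This is 1 - cosh^2 = - sinh^2; one factor \<open>z - w\<close> then cancels the
    denominator of \<open>?u\<close>.\<close>
  have D: "1 - ?m * ?m = - (((z - w) * (z - w)) / 4)"
    using zw by (simp add: field_simps)
  have "m * t - (u - m * (m * u)) = m * t - (1 - m * m) * u" for m t u :: real
    by (simp add: algebra_simps)
  then have "?m * ?t - (?u - ?m * (?m * ?u)) = ?m * ?t - (1 - ?m * ?m) * ?u" .
  also have "\<dots> = ?m * ?t + (z - w) * (P - Q) / 4"
  proof -
    have "- (e * e / 4) * (X / e) = - (e * X / 4)" if "e \<noteq> 0" for e X :: real
      using that by simp
    from this[OF d] show ?thesis unfolding D by simp
  qed
  also have "\<dots> = (z * P + w * Q) / 2"
    by (simp add: field_simps)
  finally have 1: "?m * ?t - (?u - ?m * (?m * ?u)) = (z * P + w * Q) / 2" .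
  have 2: "?t + ?m * ?u = (z * P - w * Q) / (z - w)"
  proof -
    have "(?t + ?m * ?u) * (z - w) = ?t * (z - w) + ?m * (?u * (z - w))"
      by (simp only: distrib_right mult.assoc)
    also have "\<dots> = ?t * (z - w) + ?m * (P - Q)" using d by simp
    also have "\<dots> = z * P - w * Q" by (simp add: field_simps)
    finally show ?thesis using d by (simp add: eq_divide_eq)
  qed
  have IH: "chebyshev_pair ((*) ?m) 1 k = (?t, ?u)"
    using Suc by (simp only: w_def[symmetric] P_def Q_def)
  show ?case
    unfolding w_def[symmetric] chebyshev_pair.simps IH Let_def prod.case 1 2
    by (simp add: P_def Q_def)
qed

section \<open>Krylov subspaces\<close>

lemma subspace_krylov: "subspace (krylov B b k)"
  by (simp add: krylov_def)

lemma krylov_mono: "i \<le> k \<Longrightarrow> krylov B b i \<subseteq> krylov B b k"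
  unfolding krylov_def by (intro span_mono) auto

lemma krylov_mult:
  assumes "v \<in> krylov B b k"
  shows "B *v v \<in> krylov B b (Suc k)"
proof -
  have "(*v) B ` krylov B b k = span ((*v) B ` {((*v) B ^^ i) b | i. i < k})"
    unfolding krylov_def by (rule linear_span_image[symmetric]) simp
  also have "\<dots> \<subseteq> krylov B b (Suc k)"
    unfolding krylov_def
  proof (rule span_mono, safe)
    fix i assume "i < k"
    then show "\<exists>l. B *v ((*v) B ^^ i) b = ((*v) B ^^ l) b \<and> l < Suc k"
      by (intro exI[of _ "Suc i"]) simp
  qed
  finally show ?thesis using assms by blast
qed

text \<open>For a polynomial p, p(M) - p(\<mu>) is a polynomial in \<open>B\<close> without constant
  term, and \<open>B *v x = b\<close> turns one factor \<open>B\<close> into \<open>b\<close>. The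
  degrees k + 1 and k of the two polynomials give the two Krylov indices; starting at
  \<open>Suc k\<close> keeps the second one nonnegative.\<close>

lemma chebyshev_pair_krylov:
  fixes B :: "real^'n^'n"
  assumes M: "\<And>v. M v = \<mu> *\<^sub>R v - c *\<^sub>R (B *v v)" and x: "B *v x = b"
    and "chebyshev_pair M x (Suc k) = (t, u)"
    and "chebyshev_pair ((*) \<mu>) 1 (Suc k) = (\<tau>, \<upsilon>)"
  shows "t - \<tau> *\<^sub>R x \<in> krylov B b (Suc k) \<and> u - \<upsilon> *\<^sub>R x \<in> krylov B b k"
  using assms(3,4)
proof (induction k arbitrary: t u \<tau> \<upsilon>)
  case 0
  have "b \<in> krylov B b 1"
    unfolding krylov_def by (rule span_base) (auto intro: exI[of _ 0])
  moreover have "t - \<tau> *\<^sub>R x = - (c *\<^sub>R b)"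
    using 0 x by (auto simp: M)
  ultimately have "t - \<tau> *\<^sub>R x \<in> krylov B b 1"
    by (simp add: subspace_neg[OF subspace_krylov] subspace_scale[OF subspace_krylov])
  then show ?case
    using 0 by (simp add: M subspace_0[OF subspace_krylov])
next
  case (Suc k)
  let ?K = "krylov B b"
  note sub = subspace_add[OF subspace_krylov] subspace_diff[OF subspace_krylov]
    subspace_scale[OF subspace_krylov] subspace_neg[OF subspace_krylov]
  obtain t' u' \<tau>' \<upsilon>' where
    tu: "chebyshev_pair M x (Suc k) = (t', u')"
    and tu': "chebyshev_pair ((*) \<mu>) 1 (Suc k) = (\<tau>', \<upsilon>')"
    by fastforce
  have eqs: "t = M t' - (u' - M (M u'))" "u = t' + M u'"
      "\<tau> = \<mu> * \<tau>' - (\<upsilon>' - \<mu> * (\<mu> * \<upsilon>'))" "\<upsilon> = \<tau>' + \<mu> * \<upsilon>'"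
    using Suc.prems unfolding chebyshev_pair.simps(2)[of _ _ "Suc k"] tu tu' by auto
  have b: "b \<in> ?K (Suc i)" for i
    unfolding krylov_def by (rule span_base) (auto intro: exI[of _ 0])
  have M_step: "M v - (\<mu> * \<alpha>) *\<^sub>R x \<in> ?K (Suc i)" if "v - \<alpha> *\<^sub>R x \<in> ?K i" for v \<alpha> i
  proof -
    have "M v - (\<mu> * \<alpha>) *\<^sub>R x =
        \<mu> *\<^sub>R (v - \<alpha> *\<^sub>R x) - c *\<^sub>R (B *v (v - \<alpha> *\<^sub>R x)) - (c * \<alpha>) *\<^sub>R b"
      using x by (simp add: M algebra_simps matrix_vector_mult_diff_distrib matrix_vector_mult_scaleR)
    moreover have "v - \<alpha> *\<^sub>R x \<in> ?K (Suc i)"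
      using that krylov_mono[of i "Suc i" B b] by auto
    ultimately show ?thesis
      using krylov_mult[OF that] b by (simp only: sub)
  qed
  have IH: "t' - \<tau>' *\<^sub>R x \<in> ?K (Suc k)" "u' - \<upsilon>' *\<^sub>R x \<in> ?K k"
    using Suc.IH[OF tu tu'] by auto
  have Mt: "M t' - (\<mu> * \<tau>') *\<^sub>R x \<in> ?K (Suc (Suc k))"
    and Mu: "M u' - (\<mu> * \<upsilon>') *\<^sub>R x \<in> ?K (Suc k)"
    and MMu: "M (M u') - (\<mu> * (\<mu> * \<upsilon>')) *\<^sub>R x \<in> ?K (Suc (Suc k))"
    using IH M_step by blast+
  have u': "u' - \<upsilon>' *\<^sub>R x \<in> ?K (Suc (Suc k))"
    using IH(2) krylov_mono[of k "Suc (Suc k)" B b] by auto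
  have "t - \<tau> *\<^sub>R x = (M t' - (\<mu> * \<tau>') *\<^sub>R x) -
      ((u' - \<upsilon>' *\<^sub>R x) - (M (M u') - (\<mu> * (\<mu> * \<upsilon>')) *\<^sub>R x))"
    by (simp add: eqs algebra_simps)
  moreover have "u - \<upsilon> *\<^sub>R x = (t' - \<tau>' *\<^sub>R x) + (M u' - (\<mu> * \<upsilon>') *\<^sub>R x)"
    by (simp add: eqs algebra_simps)
  ultimately show ?case
    using Mt Mu MMu u' IH(1) by (simp only: sub)
qed

section \<open>Spectral bounds and the energy norm\<close>

text \<open>The operator inequality B^2 \<le> h B, with h the norm of \<open>B\<close>, follows by
  evaluating the positive form of \<open>B\<close> at h v - B v.\<close>

lemma spd_norm_mult_sq_le:
  fixes B :: "real^'n^'n"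
  assumes B: "spd B"
  shows "(B *v v) \<bullet> (B *v v) \<le> onorm ((*v) B) * (v \<bullet> (B *v v))"
proof -
  let ?w = "B *v v" and ?h = "onorm ((*v) B)"
  have bl: "bounded_linear ((*v) B)" by simp
  have h: "0 \<le> ?h" using bl by (rule onorm_pos_le)
  have psd: "0 \<le> x \<bullet> (B *v x)" for x
    using B unfolding spd_def by (cases "x = 0") (auto intro: less_imp_le)
  have "?w \<bullet> (B *v ?w) \<le> norm ?w * norm (B *v ?w)" by (rule norm_cauchy_schwarz)
  also have "\<dots> \<le> norm ?w * (?h * norm ?w)"
    by (intro mult_left_mono onorm[OF bl]) auto
  finally have w: "?w \<bullet> (B *v ?w) \<le> ?h * (?w \<bullet> ?w)"
    by (simp add: dot_square_norm power2_eq_square algebra_simps)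
  have vw: "v \<bullet> (B *v ?w) = ?w \<bullet> ?w" by (rule spd_inner_commute[OF B])
  have "0 \<le> (?h *\<^sub>R v - ?w) \<bullet> (B *v (?h *\<^sub>R v - ?w))" by (rule psd)
  also have "\<dots> = ?h * (?h * (v \<bullet> ?w)) - 2 * ?h * (?w \<bullet> ?w) + ?w \<bullet> (B *v ?w)"
    using vw by (simp add: matrix_vector_mult_diff_distrib matrix_vector_mult_scaleR
        inner_diff_left inner_diff_right algebra_simps)
  finally have *: "0 \<le> ?h * (?h * (v \<bullet> ?w) - ?w \<bullet> ?w)"
    using w by (simp add: algebra_simps)
  show ?thesis
  proof (cases "?h = 0")
    case True
    then have "?w = 0" using onorm_eq_0[OF bl] by auto
    then show ?thesis by simp
  next
    case False
    then show ?thesis using * h by (simp add: zero_le_mult_iff)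
  qed
qed

lemma spd_inverse_norm_le:
  fixes B :: "real^'n^'n"
  assumes B: "spd B"
  shows "norm v \<le> onorm ((*v) (matrix_inv B)) * norm (B *v v)"
proof -
  have "invertible B"
    using spd_inj[OF B] invertible_left_inverse matrix_left_invertible_injective by blast
  then have "matrix_inv B ** B = mat 1"
    unfolding invertible_def matrix_inv_def by (rule someI2_ex) simp
  then have "matrix_inv B *v (B *v v) = v"
    by (simp add: matrix_vector_mul_assoc)
  then show ?thesis
    using onorm[of "(*v) (matrix_inv B)" "B *v v"] by simp
qed

text \<open>The Galerkin error is \<open>B\<close>-orthogonal to \<open>V\<close>, so Pythagoras
  applies to x - y = \<open>?e + ?d\<close>.\<close>

lemma galerkin_optimal:
  fixes B :: "real^'n^'n"
  assumes B: "spd B" and V: "subspace V" and x: "B *v x = b" and y: "y \<in> V"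
  shows "energy_norm B (x - subspace_solution B b V) \<le> energy_norm B (x - y)"
proof -
  let ?s = "subspace_solution B b V"
  have "is_subspace_solution B b V ?s"
    unfolding subspace_solution_def by (rule theI'[OF ex1_subspace_solution[OF B V]])
  then have s: "?s \<in> V" "\<And>v. v \<in> V \<Longrightarrow> v \<bullet> (B *v ?s) = v \<bullet> b"
    by (auto simp: is_subspace_solution_iff[OF V])
  let ?e = "x - ?s" and ?d = "?s - y"
  have "?d \<in> V" using s(1) y V by (simp add: subspace_diff)
  then have 1: "?d \<bullet> (B *v ?e) = 0"
    using s(2) x by (simp add: matrix_vector_mult_diff_distrib inner_diff_right)
  then have 2: "?e \<bullet> (B *v ?d) = 0"
    using spd_inner_commute[OF B, of ?e ?d] by (simp add: inner_commute)
  have 3: "0 \<le> ?d \<bullet> (B *v ?d)"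
    using B unfolding spd_def by (cases "?d = 0") (auto intro: less_imp_le)
  have "x - y = ?e + ?d" by simp
  then have "(x - y) \<bullet> (B *v (x - y)) = ?e \<bullet> (B *v ?e) + ?d \<bullet> (B *v ?d)"
    using 1 2 by (simp only: matrix_vector_right_distrib inner_add_left inner_add_right)
  then show ?thesis using 3 by (simp add: energy_norm_def)
qed

text \<open>The Chebyshev variable is \<open>M = (h + l - 2B) / (h - l)\<close>, whose value at \<open>B = 0\<close> is
  \<open>(z + 1/z) / 2\<close> with \<open>1/z\<close> the convergence rate.\<close>

lemma krylov_approximation:
  fixes B :: "real^'n^'n"
  assumes B: "spd B" and x: "B *v x = b" and j: "j \<ge> 1"
  shows "\<exists>y\<in>krylov B b j. energy_norm B (x - y)
    \<le> 2 * ((sqrt (cond2 B) - 1) / (sqrt (cond2 B) + 1)) ^ j * energy_norm B x"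
proof -
  define h where "h = onorm ((*v) B)"
  define g where "g = onorm ((*v) (matrix_inv B))"
  define q where "q = sqrt (cond2 B)"
  have up: "(B *v v) \<bullet> (B *v v) \<le> h * (v \<bullet> (B *v v))" for v
    unfolding h_def by (rule spd_norm_mult_sq_le[OF B])
  have lo_norm: "norm v \<le> g * norm (B *v v)" for v
    unfolding g_def by (rule spd_inverse_norm_le[OF B])
  \<comment> \<open>Together with \<open>up\<close> this replaces the spectral bounds l \<le> B
    \<le> h, where l = 1/g.\<close>
  have lo: "v \<bullet> (B *v v) \<le> g * ((B *v v) \<bullet> (B *v v))" for v
  proof -
    have "v \<bullet> (B *v v) \<le> norm v * norm (B *v v)" by (rule norm_cauchy_schwarz)
    also have "\<dots> \<le> g * norm (B *v v) * norm (B *v v)"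
      by (intro mult_right_mono lo_norm) auto
    finally show ?thesis by (simp add: dot_square_norm power2_eq_square mult.assoc)
  qed
  have g: "g > 0" and gh: "g * h \<ge> 1" and h: "h > 0"
  proof -
    obtain e :: "real^'n" where e: "norm e = 1" using vector_choose_size[of 1] by auto
    have "0 \<le> g" unfolding g_def by (rule onorm_pos_le) simp
    moreover have "norm (B *v e) \<le> h"
      using onorm[of "(*v) B" e] e by (simp add: h_def)
    moreover have "1 \<le> g * norm (B *v e)" using lo_norm[of e] e by simp
    ultimately show "g * h \<ge> 1" by (meson mult_left_mono order_trans)
    with \<open>0 \<le> g\<close> show "g > 0" "h > 0"
      by (auto simp: less_le) (smt (verit) mult_nonneg_nonpos)
  qed
  have q2: "q * q = g * h" and q1: "q \<ge> 1"
    using gh g h by (auto simp: q_def cond2_def h_def g_def mult.commute)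
  show ?thesis
  proof (cases "q = 1")
    \<comment> \<open>For condition number 1 the variable \<open>z\<close> below would divide by
      zero. Here \<open>B\<close> is h times the identity, so \<open>x\<close> itself lies in the
      Krylov space, and the bound is 0 because j \<ge> 1.\<close>
    case True
    with q2 have gh1: "g * h = 1" by simp
    have "B *v v = h *\<^sub>R v" for v
    proof -
      have "h * norm v \<le> h * (g * norm (B *v v))" using h lo_norm by simp
      then have "h * norm v \<le> norm (B *v v)"
        using gh1 by (simp add: mult.assoc[symmetric] mult.commute)
      then have "(h * norm v) * (h * norm v) \<le> norm (B *v v) * norm (B *v v)"
        using h by (intro mult_mono) auto
      then have n: "h * h * (v \<bullet> v) \<le> (B *v v) \<bullet> (B *v v)"
        by (simp add: dot_square_norm power2_eq_square algebra_simps)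
      have "(B *v v - h *\<^sub>R v) \<bullet> (B *v v - h *\<^sub>R v) =
          (B *v v) \<bullet> (B *v v) - 2 * (h * (v \<bullet> (B *v v))) + h * h * (v \<bullet> v)"
        by (simp add: inner_diff_left inner_diff_right algebra_simps inner_commute)
      also have "\<dots> \<le> 0" using n up[of v] by linarith
      finally have "B *v v - h *\<^sub>R v = 0" by (metis antisym inner_eq_zero_iff inner_ge_zero)
      then show ?thesis by simp
    qed
    then have "x = (1 / h) *\<^sub>R b" using x h by auto
    moreover have "b \<in> krylov B b j"
      unfolding krylov_def using j by (intro span_base) (auto intro!: exI[of _ 0])
    ultimately have "x \<in> krylov B b j" by (simp add: subspace_scale[OF subspace_krylov])
    moreover have "energy_norm B (x - x) = 0" by (simp add: energy_norm_def)
    ultimately show ?thesis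
      using j True by (intro bexI[of _ x]) (auto simp: q_def power_0_left)
  next
    case False
    with q1 have q: "q > 1" by simp
    define z where "z = (q + 1) / (q - 1)"
    have z: "z > 1" using q by (simp add: z_def)
    define \<mu> where "\<mu> = (z + 1 / z) / 2"
    have qq: "q * q > 1" using q by (simp add: less_1_mult)
    have mu: "\<mu> = (g * h + 1) / (g * h - 1)"
    proof -
      have nz: "q - 1 \<noteq> 0" "q + 1 \<noteq> 0" "q * q - 1 \<noteq> 0" using q qq by auto
      show ?thesis
        unfolding \<mu>_def z_def q2[symmetric] using nz
        by (simp add: divide_simps) (simp add: algebra_simps)
    qed
    \<comment> \<open>With l = 1/g, this is c = 2 / (h - l), and \<mu> = (h + l) / (h - l).\<close>
    define c where "c = 2 * g / (g * h - 1)"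
    define M where "M v = \<mu> *\<^sub>R v - c *\<^sub>R (B *v v)" for v
    define ip where "ip v w = v \<bullet> (B *v w)" for v w
    have "bilinear ip"
      unfolding bilinear_def ip_def
      by (auto intro!: linearI simp: inner_add_left inner_add_right matrix_vector_right_distrib
          matrix_vector_mult_scaleR)
    interpret selfadjoint_numerical_contraction ip M
    proof (rule selfadjoint_numerical_contraction.intro)
      show "bilinear ip" by fact
      show "ip v w = ip w v" for v w
        unfolding ip_def using spd_inner_commute[OF B] by (simp add: inner_commute)
      show "linear M"
        unfolding M_def
        by (auto intro!: linearI simp: matrix_vector_right_distrib matrix_vector_mult_scaleR
            algebra_simps)
      show "ip (M v) w = ip v (M w)" for v w
        using spd_inner_commute[OF B]
        by (simp add: ip_def M_def inner_diff_left inner_diff_right matrix_vector_mult_diff_distrib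
            matrix_vector_mult_scaleR)
      show "\<bar>ip v (M v)\<bar> \<le> ip v v" for v
      proof -
        define a where "a = v \<bullet> (B *v v)"
        define d where "d = (B *v v) \<bullet> (B *v v)"
        have pos: "g * h - 1 > 0" using qq q2 by simp
        \<comment> \<open>The numerical range of \<open>M\<close> is \<mu> a - c d; the bounds l a
          \<le> d \<le> h a are what the affine map sends to [-1, 1].\<close>
        have "a \<le> g * d" and "g * d \<le> g * (h * a)"
          using lo up g by (auto simp: a_def d_def)
        then have "\<bar>(g * h + 1) * a - 2 * g * d\<bar> \<le> (g * h - 1) * a"
          by (auto simp: abs_le_iff algebra_simps)
        moreover have "ip v (M v) = ((g * h + 1) * a - 2 * g * d) / (g * h - 1)"
          using spd_inner_commute[OF B, of v "B *v v"]
          by (simp add: ip_def M_def mu c_def a_def d_def inner_diff_right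
              matrix_vector_mult_diff_distrib matrix_vector_mult_scaleR diff_divide_distrib)
        ultimately show ?thesis
          using pos by (simp add: ip_def a_def[symmetric] abs_divide pos_divide_le_eq mult.commute)
      qed
    qed
    define \<tau> where "\<tau> = (z ^ j + (1 / z) ^ j) / 2"
    define t where "t = fst (chebyshev_pair M x j)"
    have \<tau>: "\<tau> > 0" "inverse \<tau> \<le> 2 * (1 / z) ^ j"
    proof -
      have p: "z ^ j > 0" "(1 / z) ^ j > 0" using z by auto
      then show "\<tau> > 0" by (simp add: \<tau>_def)
      \<comment> \<open>Dropping the small term \<open>(1 / z) ^ j\<close> from \<tau> produces the
        factor 2 of the bound.\<close>
      have "inverse \<tau> \<le> inverse (z ^ j / 2)"
        using p by (intro le_imp_inverse_le) (auto simp: \<tau>_def)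
      then show "inverse \<tau> \<le> 2 * (1 / z) ^ j" by (simp add: power_one_over)
    qed
    have tau: "fst (chebyshev_pair ((*) \<mu>) 1 j) = \<tau>"
      unfolding \<mu>_def chebyshev_pair_real[OF z] by (simp add: \<tau>_def)
    have K: "t - \<tau> *\<^sub>R x \<in> krylov B b j"
    proof -
      obtain k where "j = Suc k" using j by (cases j) auto
      then show ?thesis
        using chebyshev_pair_krylov[of M \<mu> c B x b k, OF M_def x] tau
        by (metis t_def prod.collapse)
    qed
    \<comment> \<open>Chosen so that x - y is T_j(M) x / \<tau>, the Chebyshev polynomial normalised
      to 1 at B = 0.\<close>
    define y where "y = (- inverse \<tau>) *\<^sub>R (t - \<tau> *\<^sub>R x)"
    have y: "y \<in> krylov B b j"
      unfolding y_def using K by (rule subspace_scale[OF subspace_krylov])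
    have xy: "x - y = inverse \<tau> *\<^sub>R t"
      using \<tau>(1) by (simp add: y_def algebra_simps)
    have "energy_norm B t \<le> energy_norm B x"
      using chebyshev_contraction[of x j] by (simp add: energy_norm_def ip_def t_def)
    moreover have "energy_norm B (x - y) = inverse \<tau> * energy_norm B t"
      using \<tau>(1) unfolding xy
      by (simp add: energy_norm_def matrix_vector_mult_scaleR real_sqrt_mult mult.assoc[symmetric])
    moreover have x0: "0 \<le> energy_norm B x"
      using B unfolding energy_norm_def spd_def by (cases "x = 0") (auto intro: less_imp_le)
    ultimately have "energy_norm B (x - y) \<le> inverse \<tau> * energy_norm B x"
      using \<tau>(1) by simp
    also have "\<dots> \<le> 2 * (1 / z) ^ j * energy_norm B x"
      using \<tau>(2) x0 by (rule mult_right_mono)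
    finally show ?thesis
      using y by (auto simp: z_def q_def)
  qed
qed

section \<open>Compound Krylov subspaces\<close>

lemma mat_range_eq_span: "mat_range C = span (set C)"
proof
  show "mat_range C \<subseteq> span (set C)"
    unfolding mat_range_def using mult_vec_in_span by auto
  have "subspace (mat_range C)"
    unfolding subspace_def
  proof (intro conjI ballI allI)
    show "0 \<in> mat_range C"
      unfolding mat_range_def by (rule range_eqI[of _ _ "\<lambda>_. 0"]) (simp add: mult_vec_def)
  next
    fix x y assume "x \<in> mat_range C" "y \<in> mat_range C"
    then obtain z z' where "x = mult_vec C z" "y = mult_vec C z'" by (auto simp: mat_range_def)
    then have "x + y = mult_vec C (\<lambda>i. z i + z' i)"
      by (simp add: mult_vec_def scaleR_add_left sum.distrib)
    then show "x + y \<in> mat_range C" by (simp add: mat_range_def)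
  next
    fix a x assume "x \<in> mat_range C"
    then obtain z where "x = mult_vec C z" by (auto simp: mat_range_def)
    then have "a *\<^sub>R x = mult_vec C (\<lambda>i. a * z i)"
      by (simp add: mult_vec_def scaleR_sum_right)
    then show "a *\<^sub>R x \<in> mat_range C" by (simp add: mat_range_def)
  qed
  moreover have "set C \<subseteq> mat_range C"
  proof
    fix v assume "v \<in> set C"
    then obtain i where i: "i < length C" "v = C ! i" by (auto simp: in_set_conv_nth)
    have "mult_vec C (\<lambda>k. if k = i then 1 else 0) =
        (\<Sum>k<length C. if k = i then C ! k else 0)"
      unfolding mult_vec_def by (intro sum.cong) auto
    also have "\<dots> = v" using i by simp
    finally show "v \<in> mat_range C" unfolding mat_range_def by (metis rangeI)
  qed
  ultimately show "span (set C) \<subseteq> mat_range C" by (intro span_minimal)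
qed

text \<open>\<open>A \<sigma>\<close> is a combination of the coefficient matrices, so it maps each
  column \<open>c\<close> of \<open>C\<close> to a combination of the columns
  \<open>coeff_mat A i *v c\<close> of the linearisation, with coefficients \<sigma>_i.\<close>

lemma mult_mem_mat_range_linearisation:
  assumes A: "linear A" and v: "v \<in> mat_range C"
  shows "A \<sigma> *v v \<in> mat_range (linearisation A C)"
proof -
  have base: "A \<sigma> *v c \<in> span (set (linearisation A C))" if "c \<in> set C" for c
  proof -
    have "A \<sigma> *v c = (\<Sum>i\<in>UNIV. (\<sigma> $ i *\<^sub>R coeff_mat A i) *v c)"
      by (subst linear_coeff_mat_expansion[OF A])
        (simp add: linear_sum[of "\<lambda>X. X *v c"] linearI matrix_vector_mult_add_rdistrib
          scaleR_matrix_vector_assoc[symmetric])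
    also have "\<dots> = (\<Sum>i\<in>UNIV. \<sigma> $ i *\<^sub>R (coeff_mat A i *v c))"
      by (simp add: scaleR_matrix_vector_assoc)
    also have "\<dots> \<in> span (set (linearisation A C))"
      using that by (intro span_sum span_scale span_base) (auto simp: linearisation_def)
    finally show ?thesis .
  qed
  have "A \<sigma> *v v \<in> (*v) (A \<sigma>) ` span (set C)" using v by (simp add: mat_range_eq_span)
  also have "\<dots> = span ((*v) (A \<sigma>) ` set C)" by (simp add: linear_span_image)
  also have "\<dots> \<subseteq> span (set (linearisation A C))"
    using base by (intro span_minimal) auto
  finally show ?thesis by (simp add: mat_range_eq_span)
qed

lemma power_mem_mat_range:
  assumes "linear A"
  shows "((*v) (A \<sigma>) ^^ i) b \<in> mat_range ((linearisation A ^^ i) [b])"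
proof (induction i)
  case 0
  then show ?case by (simp add: mat_range_eq_span span_base)
next
  case (Suc i)
  then show ?case using mult_mem_mat_range_linearisation[OF assms] by simp
qed

lemma subspace_compound_krylov: "subspace (compound_krylov A b j)"
  by (induction A b j rule: compound_krylov.induct)
    (auto simp: mat_range_eq_span simp del: funpow.simps intro!: subspace_sums)

lemma mat_range_subset_compound_krylov:
  "i < j \<Longrightarrow> mat_range ((linearisation A ^^ i) [b]) \<subseteq> compound_krylov A b j"
proof (induction A b j rule: compound_krylov.induct)
  case (1 A b)
  then show ?case by simp
next
  case (2 A b)
  then show ?case by (simp add: mat_range_eq_span)
next
  case (3 A b j)
  let ?R = "mat_range ((linearisation A ^^ Suc j) [b])"
  have sums: "compound_krylov A b (Suc (Suc j)) =
      {u + v | u v. u \<in> ?R \<and> v \<in> compound_krylov A b (Suc j)}" by simp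
  show ?case
  proof (cases "i = Suc j")
    case True
    have "0 \<in> compound_krylov A b (Suc j)"
      using subspace_compound_krylov by (rule subspace_0)
    then show ?thesis unfolding True sums by force
  next
    case False
    with 3 have "mat_range ((linearisation A ^^ i) [b]) \<subseteq> compound_krylov A b (Suc j)"
      by simp
    moreover have "0 \<in> ?R" by (simp add: mat_range_eq_span span_zero del: funpow.simps)
    ultimately show ?thesis unfolding sums by force
  qed
qed

text \<open>The i-th Krylov generator lies in the range of the i-th iterated linearisation, and for
  i < j that range is one of the summands of the compound space.\<close>

lemma krylov_subset_compound_krylov:
  assumes "linear A"
  shows "krylov (A \<sigma>) b j \<subseteq> compound_krylov A b j"
  unfolding krylov_def
  using power_mem_mat_range[OF assms] mat_range_subset_compound_krylov
  by (intro span_minimal subspace_compound_krylov) blast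

theorem mainTheorem3:
  fixes S :: "(real^'s::{finite,linorder}) set"
    and b :: "real^'n"
    and A :: "real^'s::{finite,linorder} \<Rightarrow> real^'n^'n"
  assumes "linear A"
    and "\<And>\<sigma>. \<sigma> \<in> S \<Longrightarrow> spd (A \<sigma>)"
  shows "\<forall>\<sigma>\<in>S. \<forall>j\<ge>1.
    krylov (A \<sigma>) b j \<subseteq> compound_krylov A b j \<and>
    (\<forall>x. A \<sigma> *v x = b \<longrightarrow>
      energy_norm (A \<sigma>) (x - subspace_solution (A \<sigma>) b (compound_krylov A b j))
        \<le> 2 * ((sqrt (cond2 (A \<sigma>)) - 1) / (sqrt (cond2 (A \<sigma>)) + 1)) ^ j
            * energy_norm (A \<sigma>) x)"
proof (intro ballI allI impI conjI)
  fix \<sigma> and j :: nat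
  assume \<sigma>: "\<sigma> \<in> S" and j: "1 \<le> j"
  show sub: "krylov (A \<sigma>) b j \<subseteq> compound_krylov A b j"
    by (rule krylov_subset_compound_krylov[OF assms(1)])
  fix x assume x: "A \<sigma> *v x = b"
  have B: "spd (A \<sigma>)" using assms(2) \<sigma> .
  show "energy_norm (A \<sigma>) (x - subspace_solution (A \<sigma>) b (compound_krylov A b j))
      \<le> 2 * ((sqrt (cond2 (A \<sigma>)) - 1) / (sqrt (cond2 (A \<sigma>)) + 1)) ^ j * energy_norm (A \<sigma>) x"
    \<comment> \<open>The Krylov approximant also lies in the larger compound space, where the
      Galerkin solution is at least as good.\<close>
    using krylov_approximation[OF B x j] galerkin_optimal[OF B subspace_compound_krylov x] sub
    by (meson order_trans subsetD)
qed

end
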